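(* Let $X$ and $Y$ be Banach spaces, let $F \colon X \rightrightarrows Y$ be a set-valued mapping with closed graph, and let $\bar{y} \in J(F)$. Then $$\inf_{f \in \mathscr{F}} \{\mathrm{lip} f(\infty) \mid F + f \text{ is not metrically regular at } (\infty, \bar{y}) \} \;\geq\; \frac{1}{\mathrm{reg} F (\infty, \bar{y})}.$$ When $X$ and $Y$ are finite-dimensional, the inequality becomes an equation; moreover, in this case the infimum is unchanged if it is restricted to those mappings $f \in \mathscr{F}$ that are rank one Lipschitz.
   Context: Norms are denoted $\|\cdot\|$; all finite-dimensional spaces are equipped with the usual scalar product and the corresponding Euclidean norm. Conventions: $\frac{1}{0}=\infty$, $\frac{1}{\infty}=0$, $\inf\emptyset=\infty$; $\mathrm{dist}(x,C):=\inf\{\|x-x'\| \mid x'\in C\}$ (so it is $\infty$ if $C=\emptyset$). $\mathbb{B}_r$ is the open ball of radius $r$ centered at the origin. A neighborhood of the infinity in $X$ is a set $X\setminus\mathbb{B}_r$ for some $r>0$. For a set-valued mapping $F\colon X\rightrightarrows Y$, $\mathrm{gph}F:=\{(x,y)\in X\times Y\mid y\in F(x)\}$ and $F^{-1}(y):=\{x\in X\mid y\in F(x)\}$. For single-valued $f\colon X\to Y$, $(F+f)(x):=\{y+f(x)\mid y\in F(x)\}$. The Jelonek set $J(F)$ is the set of $y\in Y$ for which there is a sequence $(x_k,y_k)\in\mathrm{gph}F$ with $\|x_k\|\to\infty$ and $y_k\to y$. (If $\bar y\in J(F)$ and $\lim_{\|x\|\to\infty}\|f(x)\|=0$, then $\bar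 y\in J(F+f)$.) Metric regularity at infinity: for $\bar{y}\in J(F)$, $F$ is metrically regular at $(\infty,\bar y)$ if there are constants $\kappa>0$, $\gamma>0$, a neighborhood $U$ of the infinity in $X$, and a neighborhood $V$ of $\bar y$ in $Y$ such that for all $(x,y)\in U\times V$ with $\mathrm{dist}(y,F(x))<\gamma$ one has $\mathrm{dist}(x,F^{-1}(y))\leq\kappa\,\mathrm{dist}(y,F(x))$. The infimum of the set of values $\kappa$ for which this holds is the modulus $\mathrm{reg}F(\infty,\bar y)$; $\mathrm{reg}F(\infty,\bar y)=\infty$ corresponds to the absence of metric regularity at $(\infty,\bar y)$. For a single-valued $f\colon X\to Y$, $\mathrm{lip}f(\infty):=\limsup_{\|x\|\to\infty,\ \|x'\|\to\infty,\ x\neq x'}\frac{\|f(x)-f(x')\|}{\|x-x'\|}$. $\mathscr{F}$ is the set of single-valued mappings $f\colon X\to Y$ with $\lim_{\|x\|\to\infty}\|f(x)\|=0$ and $\mathrm{lip}f(\infty)<\infty$. A mapping $f\colon X\to Y$ is rank one Lipschitz if for every $x\in X$ there is a neighborhood $U$ of $x$ in $X$ on which $f(u)=\xi(u)y$ for all $u\in U$, where $\xi\colon U\to\mathbb{R}$ is Lipschitz continuous and $y\in Y$. *)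

theory Defs
  imports "HOL-Analysis.Analysis"
begin

text \<open>Set-valued mappings from X to Y are functions of type \<open>'a \<Rightarrow> 'b set\<close>; extended-real
  quantities live in \<^typ>\<open>ereal\<close>, where \<open>1 / 0 = \<infinity>\<close>, \<open>1 / \<infinity> = 0\<close> and \<open>Inf {} = \<infinity>\<close>.\<close>

definition gph :: "('a \<Rightarrow> 'b set) \<Rightarrow> ('a \<times> 'b) set" where
  "gph F = {(x, y). y \<in> F x}"

definition inv_map :: "('a \<Rightarrow> 'b set) \<Rightarrow> 'b \<Rightarrow> 'a set" where
  "inv_map F y = {x. y \<in> F x}"

definition plus_map :: "('a \<Rightarrow> 'b::plus set) \<Rightarrow> ('a \<Rightarrow> 'b) \<Rightarrow> 'a \<Rightarrow> 'b set" where
  "plus_map F f x = {y + f x |y. y \<in> F x}"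

text \<open>The library's \<^const>\<open>infdist\<close> and \<^const>\<open>setdist\<close> are 0 on the empty set; here the
  distance to the empty set has to be \<open>\<infinity>\<close>.\<close>

definition edist_set :: "'a::metric_space \<Rightarrow> 'a set \<Rightarrow> ereal" where
  "edist_set x C = (INF x'\<in>C. ereal (dist x x'))"

definition nbhd_infinity :: "'a::real_normed_vector set \<Rightarrow> bool" where
  "nbhd_infinity U \<longleftrightarrow> (\<exists>r>0. U = UNIV - ball 0 r)"

definition jelonek_set ::
    "('a::real_normed_vector \<Rightarrow> 'b::real_normed_vector set) \<Rightarrow> 'b set" where
  "jelonek_set F = {y. \<exists>xs ys. (\<forall>k::nat. (xs k, ys k) \<in> gph F) \<and>
     filterlim (\<lambda>k. norm (xs k)) at_top sequentially \<and> ys \<longlonglongrightarrow> y}"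

text \<open>The following three notions are meant for \<open>ybar \<in> jelonek_set F\<close>. This is not part of the
  definitions: the property is inherited by the perturbed mappings that are considered, see
  \<open>jelonek_set_plus_map\<close> below.\<close>

definition metrically_regular_with ::
    "real \<Rightarrow> ('a::real_normed_vector \<Rightarrow> 'b::real_normed_vector set) \<Rightarrow> 'b \<Rightarrow> bool" where
  "metrically_regular_with \<kappa> F ybar \<longleftrightarrow>
     \<kappa> > 0 \<and> (\<exists>\<gamma>::real. \<gamma> > 0 \<and> (\<exists>U V. nbhd_infinity U \<and> ybar \<in> interior V \<and>
       (\<forall>x\<in>U. \<forall>y\<in>V. edist_set y (F x) < ereal \<gamma> \<longrightarrow>
          edist_set x (inv_map F y) \<le> ereal \<kappa> * edist_set y (F x))))"

definition metrically_regular_at_infinity ::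
    "('a::real_normed_vector \<Rightarrow> 'b::real_normed_vector set) \<Rightarrow> 'b \<Rightarrow> bool" where
  "metrically_regular_at_infinity F ybar \<longleftrightarrow> (\<exists>\<kappa>. metrically_regular_with \<kappa> F ybar)"

definition reg_infinity ::
    "('a::real_normed_vector \<Rightarrow> 'b::real_normed_vector set) \<Rightarrow> 'b \<Rightarrow> ereal" where
  "reg_infinity F ybar = Inf {ereal \<kappa> |\<kappa>. metrically_regular_with \<kappa> F ybar}"

definition lip_infinity ::
    "('a::real_normed_vector \<Rightarrow> 'b::real_normed_vector) \<Rightarrow> ereal" where
  "lip_infinity f =
     Limsup (inf (at_infinity \<times>\<^sub>F at_infinity) (principal {(x, x'). x \<noteq> x'}))
       (\<lambda>(x, x'). ereal (norm (f x - f x') / norm (x - x')))"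

definition perturbations ::
    "('a::real_normed_vector \<Rightarrow> 'b::real_normed_vector) set" where
  "perturbations = {f. ((\<lambda>x. norm (f x)) \<longlongrightarrow> 0) at_infinity \<and> lip_infinity f < \<infinity>}"

definition rank_one_lipschitz ::
    "('a::real_normed_vector \<Rightarrow> 'b::real_normed_vector) \<Rightarrow> bool" where
  "rank_one_lipschitz f \<longleftrightarrow>
     (\<forall>x. \<exists>U. x \<in> interior U \<and>
       (\<exists>(\<xi>::'a \<Rightarrow> real) y. (\<exists>L. L-lipschitz_on U \<xi>) \<and> (\<forall>u\<in>U. f u = \<xi> u *\<^sub>R y)))"

text \<open>Finite-dimensional spaces carry the Euclidean norm, i.e. there is a finite orthonormal
  basis \<open>B\<close>. In contrast to the class \<^class>\<open>euclidean_space\<close>, this is a property of a given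
  normed space, and it includes dimension 0.\<close>

definition finite_dim_euclidean :: "'a::real_normed_vector itself \<Rightarrow> bool" where
  "finite_dim_euclidean _ \<longleftrightarrow>
     (\<exists>B::'a set. finite B \<and> span B = UNIV \<and>
       (\<forall>c. norm (\<Sum>b\<in>B. c b *\<^sub>R b) = sqrt (\<Sum>b\<in>B. (c b)\<^sup>2)))"

lemma finite_dim_euclidean_euclidean_space:
  "finite_dim_euclidean TYPE('a::euclidean_space)"
proof -
  have "norm (\<Sum>b\<in>Basis. c b *\<^sub>R b) = sqrt (\<Sum>b\<in>Basis. (c b)\<^sup>2)" for c :: "'a \<Rightarrow> real"
  proof -
    have "norm x = sqrt (\<Sum>b\<in>Basis. (x \<bullet> b)\<^sup>2)" for x :: 'a
      unfolding norm_eq_sqrt_inner by (subst euclidean_inner) (simp add: power2_eq_square)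
    from this[of "\<Sum>b\<in>Basis. c b *\<^sub>R b"] show ?thesis
      by simp
  qed
  then show ?thesis
    unfolding finite_dim_euclidean_def using finite_Basis span_Basis by blast
qed

lemma jelonek_set_plus_map:
  assumes "ybar \<in> jelonek_set F" and "((\<lambda>x. norm (f x)) \<longlongrightarrow> 0) at_infinity"
  shows "ybar \<in> jelonek_set (plus_map F f)"
proof -
  obtain xs ys where *: "\<And>k::nat. (xs k, ys k) \<in> gph F"
      "filterlim (\<lambda>k. norm (xs k)) at_top sequentially" "ys \<longlonglongrightarrow> ybar"
    using assms(1) unfolding jelonek_set_def by auto
  have "filterlim xs at_infinity sequentially"
    using *(2) by (rule filterlim_norm_at_top_imp_at_infinity)
  then have "(\<lambda>k. f (xs k)) \<longlonglongrightarrow> 0"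
    by (rule filterlim_compose[OF tendsto_norm_zero_cancel[OF assms(2)]])
  then have "(\<lambda>k. ys k + f (xs k)) \<longlonglongrightarrow> ybar"
    using tendsto_add[OF *(3), of "\<lambda>k. f (xs k)" 0] by simp
  moreover have "(xs k, ys k + f (xs k)) \<in> gph (plus_map F f)" for k
    using *(1)[of k] by (auto simp: gph_def plus_map_def)
  ultimately show ?thesis
    unfolding jelonek_set_def mem_Collect_eq using *(2)
    by (intro exI[of _ xs] exI[of _ "\<lambda>k. ys k + f (xs k)"]) simp
qed

end

theory Submission
  imports Defs
begin

text \<open>The lower bound is a Lyusternik--Graves iteration: if \<open>F\<close> is regular with constant \<open>\<kappa>\<close> and
  \<open>f\<close> is \<open>L\<close>-Lipschitz near infinity with \<open>\<kappa> L < 1\<close>, then solving \<open>y - f u\<^sub>n \<in> F u\<^sub>n\<^sub>+\<^sub>1\<close> yields a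
  geometrically convergent sequence that stays near infinity, and its limit solves \<open>y \<in> F z + f z\<close>.

  Conversely, let \<open>F\<close> fail to be regular with constant \<open>1 / \<tau>\<close>, and let \<open>\<tau> < T\<close>. Ekeland's principle
  on the graph gives, arbitrarily far out, points \<open>v \<in> F x\<close>, unit vectors \<open>n\<close> and small \<open>d > 0\<close> such
  that \<open>v - s n \<in> F x'\<close> with \<open>0 \<le> s \<le> d\<close> forces \<open>s \<le> T dist x x'\<close>. Adding the bump
  \<open>- T max 0 (\<rho> - dist u x) n\<close> with \<open>T \<rho> = d / 2\<close> makes the value \<open>v - (T \<rho> + \<delta>) n\<close> unattained on the
  whole ball of radius \<open>\<rho>\<close> around \<open>x\<close>, although it has distance at most \<open>\<delta>\<close> from the image of \<open>x\<close>.
  As \<open>\<delta>\<close> is arbitrary, the sum of such bumps at separated points \<open>x\<close> tending to infinity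
  destroys regularity.\<close>

section \<open>Distances, the Lipschitz modulus and regularity in working form\<close>

lemma edist_set_nonneg: "0 \<le> edist_set x C"
  unfolding edist_set_def by (intro INF_greatest) simp

lemma edist_set_le: "c \<in> C \<Longrightarrow> edist_set x C \<le> ereal (dist x c)"
  unfolding edist_set_def by (rule INF_lower)

lemma edist_set_less_iff: "edist_set x C < a \<longleftrightarrow> (\<exists>c\<in>C. ereal (dist x c) < a)"
  unfolding edist_set_def by (rule INF_less_iff)

lemma edist_set_plus_map:
  fixes f :: "'a \<Rightarrow> 'b::real_normed_vector"
  shows "edist_set y (plus_map F f x) = edist_set (y - f x) (F x)"
proof -
  have "plus_map F f x = (\<lambda>z. z + f x) ` F x"
    by (auto simp: plus_map_def)
  moreover have "dist y (z + f x) = dist (y - f x) z" for z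
    by (simp add: dist_norm algebra_simps)
  ultimately show ?thesis
    by (simp add: edist_set_def image_image)
qed

lemma mem_inv_map_plus_map:
  fixes f :: "'a \<Rightarrow> 'b::ab_group_add"
  shows "x \<in> inv_map (plus_map F f) y \<longleftrightarrow> y - f x \<in> F x"
  by (auto simp: inv_map_def plus_map_def) (metis diff_add_cancel)

text \<open>Along the bottom filter the \<open>Limsup\<close> in \<open>lip_infinity\<close> would
  be minus infinity. An unbounded sequence excludes this, since it has two distinct terms outside
  any ball; a point of the Jelonek set supplies one.\<close>

lemma at_infinity_prod_neq_not_bot:
  assumes "filterlim (\<lambda>k. norm (xs k :: 'a::real_normed_vector)) at_top sequentially"
  shows "inf (at_infinity \<times>\<^sub>F at_infinity) (principal {(x, x'). x \<noteq> x'})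
    \<noteq> (bot :: ('a \<times> 'a) filter)"
proof
  assume "inf (at_infinity \<times>\<^sub>F at_infinity) (principal {(x, x'). x \<noteq> x'})
    = (bot :: ('a \<times> 'a) filter)"
  then have "eventually (\<lambda>(x, x'). x = x') (at_infinity \<times>\<^sub>F (at_infinity :: 'a filter))"
    by (simp add: trivial_limit_def eventually_inf_principal case_prod_beta')
  then obtain P Q where PQ: "eventually P at_infinity" "eventually Q at_infinity"
    "\<And>x y :: 'a. P x \<Longrightarrow> Q y \<Longrightarrow> x = y"
    by (auto simp: eventually_prod_filter)
  then obtain b c where bc: "\<And>x. norm x \<ge> b \<Longrightarrow> P x" "\<And>x. norm x \<ge> c \<Longrightarrow> Q x"
    by (auto simp: eventually_at_infinity)
  have ev: "\<exists>k. norm (xs k) \<ge> B" for B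
    using assms by (auto simp: filterlim_at_top eventually_sequentially)
  obtain k where k: "norm (xs k) \<ge> max b c" using ev by blast
  obtain l where l: "norm (xs l) \<ge> max (max b c) (norm (xs k) + 1)" using ev by blast
  have "xs k = xs l" by (intro PQ(3) bc) (use k l in auto)
  then show False using l by simp
qed

lemma lip_infinity_nonneg:
  assumes "filterlim (\<lambda>k. norm (xs k :: 'a::real_normed_vector)) at_top sequentially"
  shows "0 \<le> lip_infinity (f :: 'a \<Rightarrow> 'b::real_normed_vector)"
  unfolding lip_infinity_def
  by (rule le_Limsup[OF at_infinity_prod_neq_not_bot[OF assms]]) (auto intro!: always_eventually)

lemma lip_infinity_le:
  assumes "T-lipschitz_on UNIV f"
  shows "lip_infinity f \<le> ereal T"
proof -
  have "norm (f x - f x') / norm (x - x') \<le> T" if "x \<noteq> x'" for x x'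
    using lipschitz_onD[OF assms, of x x'] that by (simp add: dist_norm divide_le_eq)
  then show ?thesis
    unfolding lip_infinity_def
    by (intro Limsup_bounded) (auto simp: eventually_inf_principal intro!: always_eventually)
qed

lemma lip_infinity_lessD:
  fixes f :: "'a::real_normed_vector \<Rightarrow> 'b::real_normed_vector"
  assumes "lip_infinity f < ereal L"
  obtains R where "\<And>x x'. norm x \<ge> R \<Longrightarrow> norm x' \<ge> R \<Longrightarrow> norm (f x - f x') \<le> L * norm (x - x')"
proof -
  have "\<forall>\<^sub>F (x, x') in inf (at_infinity \<times>\<^sub>F at_infinity) (principal {(x, x'). x \<noteq> x'}).
      ereal (norm (f x - f x') / norm (x - x')) < ereal L"
    using Limsup_lessD[OF assms[unfolded lip_infinity_def]] by (simp add: case_prod_beta')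
  then have "\<forall>\<^sub>F (x, x') in at_infinity \<times>\<^sub>F at_infinity.
      x \<noteq> x' \<longrightarrow> norm (f x - f x') / norm (x - x') < L"
    by (simp add: eventually_inf_principal case_prod_beta')
  then obtain P Q where PQ: "eventually P at_infinity" "eventually Q at_infinity"
    "\<And>x x'. P x \<Longrightarrow> Q x' \<Longrightarrow> x \<noteq> x' \<Longrightarrow> norm (f x - f x') / norm (x - x') < L"
    by (auto simp: eventually_prod_filter)
  then obtain b c where bc: "\<And>x. norm x \<ge> b \<Longrightarrow> P x" "\<And>x. norm x \<ge> c \<Longrightarrow> Q x"
    by (auto simp: eventually_at_infinity)
  show thesis
  proof (rule that[of "max b c"])
    fix x x' :: 'a assume "norm x \<ge> max b c" "norm x' \<ge> max b c"
    then have "x \<noteq> x' \<Longrightarrow> norm (f x - f x') / norm (x - x') < L"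
      by (intro PQ bc) auto
    then show "norm (f x - f x') \<le> L * norm (x - x')"
      by (cases "x = x'") (auto simp: divide_less_eq)
  qed
qed

lemma metrically_regular_withE:
  assumes "metrically_regular_with \<kappa> F ybar"
  obtains \<gamma> r \<eta> where "\<kappa> > 0" "\<gamma> > 0" "r > 0" "\<eta> > 0"
    "\<And>x y. r \<le> norm x \<Longrightarrow> dist ybar y < \<eta> \<Longrightarrow> edist_set y (F x) < ereal \<gamma> \<Longrightarrow>
      edist_set x (inv_map F y) \<le> ereal \<kappa> * edist_set y (F x)"
proof -
  obtain \<gamma> r V where *: "\<kappa> > 0" "\<gamma> > 0" "r > 0" "ybar \<in> interior V"
    "\<forall>x\<in>UNIV - ball 0 r. \<forall>y\<in>V. edist_set y (F x) < ereal \<gamma> \<longrightarrow>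
      edist_set x (inv_map F y) \<le> ereal \<kappa> * edist_set y (F x)"
    using assms unfolding metrically_regular_with_def nbhd_infinity_def by blast
  obtain \<eta> where "\<eta> > 0" "ball ybar \<eta> \<subseteq> V"
    using *(4) by (auto simp: mem_interior)
  with * show thesis
    by (intro that[of \<gamma> r \<eta>]) (auto simp: subset_iff)
qed

section \<open>Stability of regularity under perturbations of small Lipschitz modulus\<close>

text \<open>The sum is regular with constant \<open>\<kappa>1 / (1 - \<kappa>1 * L)\<close> for any
  \<open>\<kappa>1\<close> strictly between \<open>\<kappa>\<close> and \<open>1 / L\<close>. The
  decay of \<open>f\<close> keeps the shifted targets \<open>y - f u\<close> in the neighborhood of
  \<open>ybar\<close> where \<open>F\<close> is regular.\<close>

lemma metrically_regular_plus_map: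
  fixes F :: "'a::banach \<Rightarrow> 'b::real_normed_vector set"
  assumes closed: "closed (gph F)"
    and reg: "metrically_regular_with \<kappa> F ybar"
    and f0: "((\<lambda>x. norm (f x)) \<longlongrightarrow> 0) at_infinity"
    and lip: "lip_infinity f < ereal L" and L: "0 < L" "\<kappa> * L < 1"
  shows "metrically_regular_at_infinity (plus_map F f) ybar"
proof -
  from reg obtain \<gamma> r \<eta> where \<kappa>: "\<kappa> > 0" and \<gamma>: "\<gamma> > 0" and r: "r > 0" and \<eta>: "\<eta> > 0"
    and mr: "\<And>x y. norm x \<ge> r \<Longrightarrow> dist ybar y < \<eta> \<Longrightarrow> edist_set y (F x) < ereal \<gamma> \<Longrightarrow>
        edist_set x (inv_map F y) \<le> ereal \<kappa> * edist_set y (F x)"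
    by (rule metrically_regular_withE) blast
  obtain R1 where R1: "\<And>x x'. norm x \<ge> R1 \<Longrightarrow> norm x' \<ge> R1 \<Longrightarrow> norm (f x - f x') \<le> L * norm (x - x')"
    using lip_infinity_lessD[OF lip] by blast
  have "\<forall>\<^sub>F x in at_infinity. norm (f x) < \<eta> / 2"
    using order_tendstoD(2)[OF f0, of "\<eta> / 2"] \<eta> by simp
  then obtain R2 where R2: "\<And>x. norm x \<ge> R2 \<Longrightarrow> norm (f x) < \<eta> / 2"
    by (auto simp: eventually_at_infinity)
  define R where "R = Max {r, R1, R2}"
  have R: "R > 0" "R \<ge> r" "R \<ge> R1" "R \<ge> R2"
    using r by (auto simp: R_def)
  \<comment> \<open>The distance to an inverse image need not be attained, so
    \<open>\<kappa>\<close> is enlarged a little, with the contraction factor \<open>q\<close> still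
    below 1.\<close>
  have "\<kappa> < 1 / L" using L by (simp add: less_divide_eq)
  then obtain \<kappa>1 where \<kappa>1: "\<kappa> < \<kappa>1" "\<kappa>1 < 1 / L" using dense by blast
  define q where "q = \<kappa>1 * L"
  have q: "0 < q" "q < 1"
    using \<kappa> \<kappa>1 L by (auto simp: q_def less_divide_eq)
  define \<kappa>2 where "\<kappa>2 = \<kappa>1 / (1 - q)"
  have \<kappa>2: "\<kappa>2 > 0" using \<kappa> \<kappa>1 q by (simp add: \<kappa>2_def)
  \<comment> \<open>An iteration started beyond \<open>r'\<close> moves by at most
    \<open>\<kappa>2 * \<gamma>\<close>, so it never leaves the region beyond
    \<open>R\<close>.\<close>
  define r' where "r' = R + \<kappa>2 * \<gamma>"
  have r': "r' > 0" using R \<kappa>2 \<gamma> by (simp add: r'_def add_pos_pos)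

  \<comment> \<open>The positive bound \<open>a\<close> replaces the distance itself, so that
    \<open>\<kappa> < \<kappa>1\<close> yields a strict inequality even where the distance is
    0.\<close>
  have solve: "\<exists>x'. y - f x' \<in> F x' \<and> norm (x' - x) \<le> \<kappa>2 * a"
    if x: "norm x \<ge> r'" and y: "y \<in> ball ybar (\<eta> / 2)"
      and a: "edist_set (y - f x) (F x) \<le> ereal a" "0 < a" "a < \<gamma>" for x y a
  proof -
    \<comment> \<open>The bound \<open>\<kappa>2 * a * (1 - q ^ n)\<close> is the sum of the first
      \<open>n\<close> step lengths \<open>\<kappa>1 * a * q ^ i\<close> permitted by
      \<open>Q\<close>.\<close>
    define P where "P n u \<longleftrightarrow> norm (u - x) \<le> \<kappa>2 * a * (1 - q ^ n) \<and>
        edist_set (y - f u) (F u) \<le> ereal (a * q ^ n)" for n u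
    define Q where "Q n u u' \<longleftrightarrow> y - f u \<in> F u' \<and> norm (u' - u) \<le> \<kappa>1 * a * q ^ n" for n u u'
    have normP: "norm u \<ge> R" if "P n u" for n u
    proof -
      have "norm (u - x) \<le> \<kappa>2 * a * (1 - q ^ n)" using that by (simp add: P_def)
      also have "\<dots> \<le> \<kappa>2 * a * 1"
        using \<kappa>2 a q by (intro mult_left_mono) auto
      also have "\<dots> \<le> \<kappa>2 * \<gamma>" using \<kappa>2 a by simp
      finally have "norm (u - x) \<le> \<kappa>2 * \<gamma>" .
      moreover have "norm x \<le> norm u + norm (u - x)"
        using norm_triangle_sub[of x u] by (simp add: norm_minus_commute)
      ultimately show ?thesis using x by (simp add: r'_def)
    qed
    have step: "\<exists>u'. P (Suc n) u' \<and> Q n u u'" if "P n u" for n u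
    proof -
      have nu: "norm u \<ge> R" by (rule normP[OF that])
      have "norm (f u) < \<eta> / 2" using nu R by (intro R2) auto
      moreover have "dist ybar (y - f u) \<le> dist ybar y + norm (f u)"
        by (metis dist_norm dist_triangle diff_diff_eq2 add_diff_cancel_left' dist_commute)
      ultimately have yV: "dist ybar (y - f u) < \<eta>" using y by simp
      have qn: "0 < q ^ n" "q ^ n \<le> 1" using q by (auto simp: power_le_one)
      have ed: "edist_set (y - f u) (F u) \<le> ereal (a * q ^ n)" using that by (simp add: P_def)
      have "a * q ^ n \<le> a * 1" using a qn by (intro mult_left_mono) auto
      then have "edist_set (y - f u) (F u) < ereal \<gamma>"
        using ed a by (smt (verit) ereal_less_eq(3) less_ereal.simps(1) order_le_less_trans)
      then have "edist_set u (inv_map F (y - f u)) \<le> ereal \<kappa> * edist_set (y - f u) (F u)"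
        using nu R yV by (intro mr) auto
      also have "\<dots> \<le> ereal \<kappa> * ereal (a * q ^ n)"
        using ed \<kappa> by (intro ereal_mult_left_mono) auto
      also have "\<dots> < ereal (\<kappa>1 * a * q ^ n)"
        using \<kappa>1 a qn by simp
      finally obtain u' where u': "y - f u \<in> F u'" "dist u u' < \<kappa>1 * a * q ^ n"
        by (auto simp: edist_set_less_iff inv_map_def)
      have "norm (u' - x) \<le> norm (u' - u) + norm (u - x)"
        by (metis norm_triangle_ineq diff_add_cancel add_diff_eq)
      also have "\<dots> \<le> \<kappa>1 * a * q ^ n + \<kappa>2 * a * (1 - q ^ n)"
        using u' that by (simp add: P_def dist_norm norm_minus_commute)
      also have "\<kappa>1 = \<kappa>2 * (1 - q)" using q by (simp add: \<kappa>2_def)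
      finally have n1: "norm (u' - x) \<le> \<kappa>2 * a * (1 - q ^ Suc n)"
        by (simp add: algebra_simps)
      have "norm x \<le> norm u' + norm (u' - x)"
        using norm_triangle_sub[of x u'] by (simp add: norm_minus_commute)
      moreover have "\<kappa>2 * a * (1 - q ^ Suc n) \<le> \<kappa>2 * a * 1"
        using \<kappa>2 a q by (intro mult_left_mono) auto
      moreover have "\<kappa>2 * a \<le> \<kappa>2 * \<gamma>" using \<kappa>2 a by simp
      ultimately have nu': "norm u' \<ge> R" using n1 x by (simp add: r'_def)
      \<comment> \<open>Since \<open>y - f u\<close> belongs to \<open>F u'\<close>, the new
        residual is at most the change of \<open>f\<close> from \<open>u\<close> to
        \<open>u'\<close>.\<close>
      have "edist_set (y - f u') (F u') \<le> ereal (dist (y - f u') (y - f u))"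
        using u' by (intro edist_set_le)
      also have "dist (y - f u') (y - f u) = norm (f u - f u')" by (simp add: dist_norm)
      also have "norm (f u - f u') \<le> L * norm (u - u')"
        using nu nu' R by (intro R1) auto
      also have "L * norm (u - u') \<le> L * (\<kappa>1 * a * q ^ n)"
        using u' L by (intro mult_left_mono) (auto simp: dist_norm)
      also have "\<dots> = a * q ^ Suc n" by (simp add: q_def)
      finally have "edist_set (y - f u') (F u') \<le> ereal (a * q ^ Suc n)" by simp
      with n1 u' show ?thesis
        by (auto simp: P_def Q_def dist_norm norm_minus_commute intro!: exI[of _ u'])
    qed
    have P0: "P 0 x" using a by (simp add: P_def)
    \<comment> \<open>The clause for \<open>n = 0\<close> in the chosen predicate pins the start of
      the sequence to \<open>x\<close>.\<close>
    have "\<exists>u. u 0 = x \<and> (\<forall>n. P n (u n)) \<and> (\<forall>n. Q n (u n) (u (Suc n)))"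
      using dependent_nat_choice[of "\<lambda>n u. P n u \<and> (n = 0 \<longrightarrow> u = x)" Q] P0 step by auto
    then obtain u where u: "u 0 = x" "\<And>n. P n (u n)" "\<And>n. Q n (u n) (u (Suc n))" by blast
    have "summable (\<lambda>n. u (Suc n) - u n)"
    proof (rule summable_norm_cancel, rule summable_comparison_test')
      show "summable (\<lambda>n. \<kappa>1 * a * q ^ n)"
        using q by (intro summable_mult summable_geometric) auto
      show "norm (norm (u (Suc n) - u n)) \<le> \<kappa>1 * a * q ^ n" if "n \<ge> 0" for n
        using u(3)[of n] by (simp add: Q_def)
    qed
    then have "(\<lambda>n. \<Sum>i<n. u (Suc i) - u i) \<longlonglongrightarrow> (\<Sum>i. u (Suc i) - u i)"
      by (rule summable_LIMSEQ)
    then have "(\<lambda>n. u n - u 0) \<longlonglongrightarrow> (\<Sum>i. u (Suc i) - u i)"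
      by (simp add: sum_lessThan_telescope)
    then have "(\<lambda>n. u n - u 0 + u 0) \<longlonglongrightarrow> (\<Sum>i. u (Suc i) - u i) + u 0"
      by (intro tendsto_intros)
    then obtain z where z: "u \<longlonglongrightarrow> z" by auto
    have nu: "norm (u n) \<ge> R" for n using normP u by blast
    have nz: "norm z \<ge> R"
      by (rule LIMSEQ_le_const[OF tendsto_norm[OF z]]) (use nu in auto)
    have bound: "norm (f (u n) - f z) \<le> L * norm (u n - z)" for n
      using nu nz R by (intro R1) (auto intro: order_trans)
    have "(\<lambda>n. L * norm (u n - z)) \<longlonglongrightarrow> 0"
      using tendsto_mult_right_zero[OF tendsto_norm_zero[OF LIM_zero[OF z]]] .
    then have "(\<lambda>n. f (u n) - f z) \<longlonglongrightarrow> 0"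
      by (rule Lim_null_comparison[OF always_eventually[OF allI[OF bound]]])
    then have "(\<lambda>n. f (u n)) \<longlonglongrightarrow> f z"
      by (rule LIM_zero_cancel)
    then have "(\<lambda>n. (u (Suc n), y - f (u n))) \<longlonglongrightarrow> (z, y - f z)"
      by (intro tendsto_Pair[OF LIMSEQ_Suc[OF z]] tendsto_diff tendsto_const)
    moreover have "(u (Suc n), y - f (u n)) \<in> gph F" for n
      using u(3)[of n] by (simp add: Q_def gph_def)
    ultimately have "(z, y - f z) \<in> gph F"
      by (rule closed_sequentially[OF closed, rotated])
    moreover have "norm (z - x) \<le> \<kappa>2 * a"
    proof (rule LIMSEQ_le_const2[OF tendsto_norm[OF tendsto_diff[OF z tendsto_const]]])
      have "norm (u n - x) \<le> \<kappa>2 * a" for n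
      proof -
        have "\<kappa>2 * a * (1 - q ^ n) \<le> \<kappa>2 * a * 1"
          using \<kappa>2 a q by (intro mult_left_mono) auto
        then show ?thesis using u(2)[of n] by (simp add: P_def)
      qed
      then show "\<exists>N. \<forall>n\<ge>N. norm (u n - x) \<le> \<kappa>2 * a" by blast
    qed
    ultimately show ?thesis by (auto simp: gph_def)
  qed

  have "edist_set x (inv_map (plus_map F f) y) \<le> ereal \<kappa>2 * edist_set y (plus_map F f x)"
    if x: "norm x \<ge> r'" and y: "y \<in> ball ybar (\<eta> / 2)"
      and d: "edist_set y (plus_map F f x) < ereal \<gamma>" for x y
  proof -
    define E where "E = edist_set x (inv_map (plus_map F f) y)"
    obtain d where dd: "edist_set y (plus_map F f x) = ereal d" "d \<ge> 0" "d < \<gamma>"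
      using d edist_set_nonneg[of y "plus_map F f x"]
      by (cases "edist_set y (plus_map F f x)") auto
    have le: "E \<le> ereal (\<kappa>2 * a)" if a: "d < a" "a < \<gamma>" for a
    proof -
      obtain x' where x': "y - f x' \<in> F x'" "norm (x' - x) \<le> \<kappa>2 * a"
        using solve[OF x y, of a] dd a by (auto simp: edist_set_plus_map)
      have "E \<le> ereal (dist x x')"
        unfolding E_def using x' by (intro edist_set_le) (simp add: mem_inv_map_plus_map)
      also have "\<dots> \<le> ereal (\<kappa>2 * a)"
        using x' by (simp add: dist_norm norm_minus_commute)
      finally show ?thesis .
    qed
    \<comment> \<open>One admissible \<open>a0\<close> shows that \<open>E\<close> is finite;
      letting \<open>a\<close> decrease to \<open>d\<close> then removes the slack.\<close>
    obtain a0 where "d < a0" "a0 < \<gamma>" using dd dense by blast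
    with le[of a0] edist_set_nonneg[of x "inv_map (plus_map F f) y"]
    obtain e where e: "E = ereal e" by (cases E) (auto simp: E_def)
    have "e / \<kappa>2 \<le> d"
      using dd(3) by (rule dense_ge_bounded) (use le e \<kappa>2 in \<open>auto simp: divide_le_eq mult.commute\<close>)
    then have "e \<le> \<kappa>2 * d" using \<kappa>2 by (simp add: divide_le_eq mult.commute)
    then show ?thesis using e dd by (simp add: E_def)
  qed
  then have "metrically_regular_with \<kappa>2 (plus_map F f) ybar"
    unfolding metrically_regular_with_def using \<kappa>2 \<gamma> r' \<eta>
    by (intro conjI exI[of _ \<gamma>] exI[of _ "UNIV - ball 0 r'"] exI[of _ "ball ybar (\<eta> / 2)"])
      (auto simp: nbhd_infinity_def not_less)
  then show ?thesis by (auto simp: metrically_regular_at_infinity_def)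
qed

section \<open>Ekeland's principle and points where regularity fails\<close>

text \<open>From \<open>p\<close>, the chain moves to a point of \<open>A p\<close> whose value is
  at most midway between \<open>\<phi> p\<close> and the infimum of \<open>\<phi>\<close> over
  \<open>A p\<close>. The decrease of \<open>\<phi>\<close> dominates the distance travelled, so the
  chain is Cauchy, and its limit is the required point.\<close>

lemma Ekeland_variational_principle:
  fixes \<phi> :: "'a::metric_space \<Rightarrow> real"
  assumes S: "complete S" "p0 \<in> S" and cont: "continuous_on S \<phi>"
    and nonneg: "\<And>p. p \<in> S \<Longrightarrow> 0 \<le> \<phi> p"
  obtains q where "q \<in> S" "\<phi> q + dist p0 q \<le> \<phi> p0" "\<And>p. p \<in> S \<Longrightarrow> \<phi> q \<le> \<phi> p + dist q p"
proof -
  define A where "A p = {q \<in> S. \<phi> q + dist p q \<le> \<phi> p}" for p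
  have "\<exists>q\<in>A p. \<forall>q'\<in>A p. 2 * \<phi> q \<le> \<phi> p + \<phi> q'" if "p \<in> S" for p
  proof -
    define m where "m = (INF q\<in>A p. \<phi> q)"
    have pA: "p \<in> A p" using that by (simp add: A_def)
    have bdd: "bdd_below (\<phi> ` A p)"
      using nonneg by (auto simp: A_def intro!: bdd_belowI[of _ 0])
    have low: "m \<le> \<phi> q" if "q \<in> A p" for q
      unfolding m_def using that bdd by (rule cINF_lower[rotated])
    show ?thesis
    \<comment> \<open>If \<open>p\<close> attains the infimum, no value lies strictly below the
      midpoint, and \<open>p\<close> itself is chosen.\<close>
    proof (cases "\<phi> p = m")
      case True
      then show ?thesis using pA low by (intro bexI[of _ p]) auto
    next
      case False
      then have "m < (\<phi> p + m) / 2" using low[OF pA] by simp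
      then obtain q where q: "q \<in> A p" "\<phi> q < (\<phi> p + m) / 2"
        unfolding m_def using cINF_less_iff[OF _ bdd] pA by blast
      then show ?thesis using low by (intro bexI[of _ q]) (auto, smt (verit))
    qed
  qed
  then obtain g where g: "\<And>p. p \<in> S \<Longrightarrow> g p \<in> A p"
    "\<And>p q'. p \<in> S \<Longrightarrow> q' \<in> A p \<Longrightarrow> 2 * \<phi> (g p) \<le> \<phi> p + \<phi> q'"
    by metis
  define u where "u n = (g ^^ n) p0" for n
  have uS: "u n \<in> S" for n
    by (induction n) (use S g in \<open>auto simp: u_def A_def\<close>)
  have suc: "u (Suc n) = g (u n)" for n by (simp add: u_def)
  have uA: "u n \<in> A (u m)" if "m \<le> n" for m n
    using that
  proof (induction n rule: dec_induct)
    case base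
    then show ?case using uS by (simp add: A_def)
  next
    case (step n)
    then show ?case
      using g(1)[OF uS[of n]] dist_triangle[of "u m" "u (Suc n)" "u n"]
      by (auto simp: A_def suc)
  qed
  have "decseq (\<lambda>n. \<phi> (u n))"
    using uA by (auto simp: decseq_def A_def) (smt (verit) zero_le_dist)
  then obtain l where l: "(\<lambda>n. \<phi> (u n)) \<longlonglongrightarrow> l"
    by (rule decseq_convergent) (use nonneg uS in auto)
  have "Cauchy u"
  proof (rule metric_CauchyI)
    fix e :: real assume "e > 0"
    with l have "Cauchy (\<lambda>n. \<phi> (u n))" by (intro LIMSEQ_imp_Cauchy)
    then obtain M where M: "\<And>m n. m \<ge> M \<Longrightarrow> n \<ge> M \<Longrightarrow> dist (\<phi> (u m)) (\<phi> (u n)) < e"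
      using \<open>e > 0\<close> metric_CauchyD by blast
    have "dist (u m) (u n) < e" if "M \<le> m" "m \<le> n" for m n
      using uA[OF that(2)] M[of m n] that by (auto simp: A_def dist_real_def)
    then show "\<exists>M. \<forall>m\<ge>M. \<forall>n\<ge>M. dist (u m) (u n) < e"
      by (metis dist_commute nle_le)
  qed
  then obtain q where q: "q \<in> S" "u \<longlonglongrightarrow> q"
    using S(1) uS by (auto simp: complete_def)
  have \<phi>q: "\<phi> q = l"
    using continuous_on_tendsto_compose[OF cont q(2) q(1)] uS l LIMSEQ_unique by auto
  have qA: "\<phi> q + dist (u n) q \<le> \<phi> (u n)" for n
  proof (rule LIMSEQ_le_const2)
    show "(\<lambda>k. \<phi> (u k) + dist (u n) (u k)) \<longlonglongrightarrow> \<phi> q + dist (u n) q"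
      unfolding \<phi>q by (intro tendsto_intros l q)
    show "\<exists>N. \<forall>k\<ge>N. \<phi> (u k) + dist (u n) (u k) \<le> \<phi> (u n)"
      using uA by (auto simp: A_def)
  qed
  \<comment> \<open>A point violating this would lie in every \<open>A (u n)\<close>; the midpoint
    property then gives \<open>l \<le> \<phi> p\<close> in the limit, against
    \<open>\<phi> p < \<phi> q = l\<close>.\<close>
  have "\<phi> q \<le> \<phi> p + dist q p" if p: "p \<in> S" for p
  proof (rule ccontr)
    assume *: "\<not> ?thesis"
    then have "p \<in> A (u n)" for n
      using p qA[of n] dist_triangle[of "u n" p q] by (simp add: A_def)
    then have "2 * \<phi> (u (Suc n)) \<le> \<phi> (u n) + \<phi> p" for n
      unfolding suc using g(2) uS by blast
    then have "2 * l \<le> l + \<phi> p"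
      by (intro LIMSEQ_le[OF tendsto_mult_left[OF LIMSEQ_Suc[OF l]] tendsto_add[OF l tendsto_const]])
        auto
    then show False using * \<phi>q by (smt (verit) zero_le_dist)
  qed
  then show thesis using that q(1) qA[of 0] by (simp add: u_def)
qed

text \<open>Ekeland's principle is applied to the distance from \<open>v\<close> to a target
  \<open>y\<close> that witnesses the failure. The vector \<open>n\<close> points from
  \<open>y\<close> to \<open>v\<close>, so \<open>v - s *\<^sub>R n\<close> is closer to
  \<open>y\<close> by exactly \<open>s\<close>; if it lies in \<open>F x'\<close>, minimality gives
  \<open>s * (1 - \<epsilon>) \<le> \<tau> * dist x x'\<close>.\<close>

lemma not_metrically_regular_withD:
  fixes F :: "'a::banach \<Rightarrow> 'b::banach set"
  assumes closed: "closed (gph F)"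
    and nreg: "\<not> metrically_regular_with (1 / \<tau>) F ybar"
    and \<tau>: "0 < \<tau>" "\<tau> < T" and e: "e > 0"
  obtains x v n d where "norm x \<ge> R" "v \<in> F x" "norm (v - ybar) < e" "norm n = 1" "0 < d" "d < e"
    "\<And>x' s. 0 \<le> s \<Longrightarrow> s \<le> d \<Longrightarrow> v - s *\<^sub>R n \<in> F x' \<Longrightarrow> s \<le> T * dist x x'"
proof -
  \<comment> \<open>Chosen so that \<open>\<tau> / (1 - \<epsilon>) = T\<close>: the gap between
    \<open>\<tau>\<close> and \<open>T\<close> pays for the motion in the image space.\<close>
  define \<epsilon> where "\<epsilon> = 1 - \<tau> / T"
  have \<epsilon>: "0 < \<epsilon>" "\<epsilon> < 1" "1 - \<epsilon> = \<tau> / T" using \<tau> by (auto simp: \<epsilon>_def)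
  \<comment> \<open>Ekeland's principle displaces \<open>x0\<close> by at most
    \<open>e / \<tau>\<close>, which leaves norm at least \<open>R\<close>; the 1 makes the radius
    positive.\<close>
  define R0 where "R0 = max 1 (R + e / \<tau>)"
  have "\<not> (\<forall>x\<in>UNIV - ball 0 R0. \<forall>y\<in>ball ybar (e / 2). edist_set y (F x) < ereal (e / 2) \<longrightarrow>
          edist_set x (inv_map F y) \<le> ereal (1 / \<tau>) * edist_set y (F x))"
  proof
    assume "\<forall>x\<in>UNIV - ball 0 R0. \<forall>y\<in>ball ybar (e / 2). edist_set y (F x) < ereal (e / 2) \<longrightarrow>
          edist_set x (inv_map F y) \<le> ereal (1 / \<tau>) * edist_set y (F x)"
    moreover have "nbhd_infinity (UNIV - ball (0::'a) R0)"
      unfolding nbhd_infinity_def by (rule exI[of _ R0]) (auto simp: R0_def)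
    moreover have "ybar \<in> interior (ball ybar (e / 2))" using e by simp
    ultimately have "metrically_regular_with (1 / \<tau>) F ybar"
      unfolding metrically_regular_with_def using \<tau> e half_gt_zero zero_less_divide_1_iff
      by blast
    then show False using nreg by simp
  qed
  then obtain x0 y where x0: "norm x0 \<ge> R0" and y: "dist ybar y < e / 2"
    and d1: "edist_set y (F x0) < ereal (e / 2)"
    and far: "ereal (1 / \<tau>) * edist_set y (F x0) < edist_set x0 (inv_map F y)"
    by (auto simp: not_le not_less)
  have "edist_set y (F x0) < edist_set x0 (inv_map F y) * ereal \<tau>"
  proof -
    obtain d where d: "edist_set y (F x0) = ereal d"
      using d1 edist_set_nonneg[of y "F x0"] by (cases "edist_set y (F x0)") auto
    show ?thesis
      using far \<tau> unfolding d
      by (cases "edist_set x0 (inv_map F y)") (auto simp: divide_less_eq)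
  qed
  \<comment> \<open>The minimum lets a single \<open>v0\<close> satisfy both strict bounds.\<close>
  with d1 have "edist_set y (F x0) < min (ereal (e / 2)) (edist_set x0 (inv_map F y) * ereal \<tau>)"
    by simp
  then obtain v0 where "v0 \<in> F x0"
    "ereal (dist y v0) < min (ereal (e / 2)) (edist_set x0 (inv_map F y) * ereal \<tau>)"
    unfolding edist_set_less_iff by blast
  then have v0: "v0 \<in> F x0" "dist y v0 < e / 2"
    "ereal (dist y v0) < edist_set x0 (inv_map F y) * ereal \<tau>"
    by auto
  have far': "dist y v0 < \<tau> * dist x0 x'" if "y \<in> F x'" for x'
  proof -
    have "edist_set x0 (inv_map F y) * ereal \<tau> \<le> ereal (dist x0 x') * ereal \<tau>"
      using that \<tau> by (intro ereal_mult_right_mono edist_set_le) (auto simp: inv_map_def)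
    then have "ereal (dist y v0) < ereal (dist x0 x') * ereal \<tau>"
      using v0 by (meson less_le_trans)
    then show ?thesis by (simp add: mult.commute)
  qed
  \<comment> \<open>Ekeland's principle on the graph with the metric \<open>\<tau> dist x x' + \<epsilon> dist v v'\<close>, which is
    realised up to equivalence by rescaling the two coordinates.\<close>
  define S where "S = {p. (fst p /\<^sub>R \<tau>, snd p /\<^sub>R \<epsilon>) \<in> gph F}"
  have "S = (\<lambda>p. (fst p /\<^sub>R \<tau>, snd p /\<^sub>R \<epsilon>)) -` gph F" by (auto simp: S_def)
  then have "closed S"
    using closed by (auto intro!: continuous_intros closed_vimage)
  then have "complete S" by (simp add: complete_eq_closed)
  moreover have "(\<tau> *\<^sub>R x0, \<epsilon> *\<^sub>R v0) \<in> S" using \<tau> \<epsilon> v0 by (simp add: S_def gph_def)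
  moreover have "continuous_on S (\<lambda>p. dist y (snd p /\<^sub>R \<epsilon>))" by (intro continuous_intros)
  ultimately obtain p where p: "p \<in> S"
    "dist y (snd p /\<^sub>R \<epsilon>) + dist (\<tau> *\<^sub>R x0, \<epsilon> *\<^sub>R v0) p \<le> dist y (snd (\<tau> *\<^sub>R x0, \<epsilon> *\<^sub>R v0) /\<^sub>R \<epsilon>)"
    "\<And>p'. p' \<in> S \<Longrightarrow> dist y (snd p /\<^sub>R \<epsilon>) \<le> dist y (snd p' /\<^sub>R \<epsilon>) + dist p p'"
    by (rule Ekeland_variational_principle) auto
  define x v where "x = fst p /\<^sub>R \<tau>" and "v = snd p /\<^sub>R \<epsilon>"
  have peq: "p = (\<tau> *\<^sub>R x, \<epsilon> *\<^sub>R v)" using \<tau> \<epsilon> by (simp add: x_def v_def)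
  have vF: "v \<in> F x" using p(1) by (simp add: S_def gph_def x_def v_def)
  have "\<tau> * dist x0 x = dist (\<tau> *\<^sub>R x0) (\<tau> *\<^sub>R x)"
    using \<tau> by (simp add: dist_norm flip: scaleR_diff_right)
  also have "\<dots> \<le> dist (\<tau> *\<^sub>R x0, \<epsilon> *\<^sub>R v0) p"
    using dist_fst_le[of "(\<tau> *\<^sub>R x0, \<epsilon> *\<^sub>R v0)" p] by (simp add: peq)
  finally have near: "dist y v + \<tau> * dist x0 x \<le> dist y v0"
    using p(2) \<epsilon> by (simp add: v_def)
  have min: "dist y v \<le> dist y v' + \<tau> * dist x x' + \<epsilon> * dist v v'" if "v' \<in> F x'" for x' v'
  proof -
    have "(\<tau> *\<^sub>R x', \<epsilon> *\<^sub>R v') \<in> S" using \<tau> \<epsilon> that by (simp add: S_def gph_def)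
    from p(3)[OF this] have "dist y v \<le> dist y v' + dist p (\<tau> *\<^sub>R x', \<epsilon> *\<^sub>R v')"
      using \<epsilon> by (simp add: v_def)
    also have "dist p (\<tau> *\<^sub>R x', \<epsilon> *\<^sub>R v') \<le> dist (\<tau> *\<^sub>R x) (\<tau> *\<^sub>R x') + dist (\<epsilon> *\<^sub>R v) (\<epsilon> *\<^sub>R v')"
      unfolding peq dist_Pair_Pair by (rule sqrt_sum_squares_le_sum) auto
    also have "\<dots> = \<tau> * dist x x' + \<epsilon> * dist v v'"
      using \<tau> \<epsilon> by (simp add: dist_norm flip: scaleR_diff_right)
    finally show ?thesis by simp
  qed
  define d where "d = dist y v"
  \<comment> \<open>If \<open>v = y\<close>, then \<open>y\<close> is in \<open>F x\<close>, and
    \<open>far'\<close> contradicts \<open>near\<close>.\<close>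
  have "v \<noteq> y"
    using far'[of x] near vF by auto
  then have d: "d > 0" by (simp add: d_def)
  have "0 \<le> \<tau> * dist x0 x" using \<tau> by simp
  then have d': "d \<le> dist y v0" using near by (simp add: d_def)
  define n where "n = (v - y) /\<^sub>R d"
  have nn: "norm n = 1" using d by (simp add: n_def d_def dist_norm norm_minus_commute)
  have vn: "v = y + d *\<^sub>R n" using d by (simp add: n_def)
  show thesis
  proof (rule that[of x v n d])
    have "\<tau> * dist x0 x \<le> e" using near v0 e zero_le_dist[of y v] by linarith
    then have "dist x0 x \<le> e / \<tau>" using \<tau> by (simp add: le_divide_eq mult.commute)
    moreover have "norm x0 \<le> norm x + dist x0 x"
      unfolding dist_norm using norm_triangle_sub[of x0 x] by simp
    ultimately show "norm x \<ge> R" using x0 by (simp add: R0_def)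
    have "dist ybar v \<le> dist ybar y + d" unfolding d_def by (rule dist_triangle)
    then show "norm (v - ybar) < e" "d < e"
      using y v0 d' e by (auto simp: dist_norm norm_minus_commute)
    fix x' s assume s: "0 \<le> s" "s \<le> d" "v - s *\<^sub>R n \<in> F x'"
    have "dist y (v - s *\<^sub>R n) = norm ((s - d) *\<^sub>R n)"
      by (simp add: vn dist_norm algebra_simps)
    also have "\<dots> = d - s" using s nn by simp
    finally have 1: "dist y (v - s *\<^sub>R n) = d - s" .
    have 2: "dist v (v - s *\<^sub>R n) = s" using s nn by (simp add: dist_norm)
    have "d \<le> d - s + \<tau> * dist x x' + \<epsilon> * s"
      using min[OF s(3)] unfolding 1 2 by (simp add: d_def)
    then have "s * (1 - \<epsilon>) \<le> \<tau> * dist x x'" by (simp add: algebra_simps)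
    then have "\<tau> * (s / T) \<le> \<tau> * dist x x'" using \<epsilon> by (simp add: algebra_simps)
    then have "s / T \<le> dist x x'" using \<tau>(1) by (rule mult_left_le_imp_le)
    then show "s \<le> T * dist x x'" using \<tau> by (simp add: divide_le_eq mult.commute)
  qed (use vF nn d in auto)
qed

section \<open>Sums of separated cone-shaped bumps\<close>

text \<open>With radii at most 1, separation 4 ensures that every open unit ball meets at most one
  of the supporting balls. This makes the sum locally rank one although the directions
  \<open>e k\<close> vary.\<close>

locale separated_bumps =
  fixes T :: real and c :: "nat \<Rightarrow> 'a::real_normed_vector" and r :: "nat \<Rightarrow> real"
    and e :: "nat \<Rightarrow> 'b::real_normed_vector"
  assumes T: "0 < T" and r: "0 < r k" "r k \<le> 1" and e: "norm (e k) = 1"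
    and separated: "i \<noteq> j \<Longrightarrow> 4 \<le> dist (c i) (c j)"
begin

definition tent :: "nat \<Rightarrow> 'a \<Rightarrow> real" where
  "tent k u = T * max 0 (r k - dist u (c k))"

text \<open>If \<open>u\<close> lies in none of the balls, the index is arbitrary, but then all tents vanish at \<open>u\<close>.\<close>

definition index :: "'a \<Rightarrow> nat" where
  "index u = (SOME k. dist u (c k) < r k)"

definition bump :: "'a \<Rightarrow> 'b" where
  "bump u = tent (index u) u *\<^sub>R e (index u)"

lemma tent_nonneg: "0 \<le> tent k u"
  using T by (simp add: tent_def)

lemma tent_pos_iff: "0 < tent k u \<longleftrightarrow> dist u (c k) < r k"
  using T by (auto simp: tent_def zero_less_mult_iff)

lemma norm_bump: "norm (bump u) = tent (index u) u"
  using tent_nonneg e by (simp add: bump_def)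

lemma index_eqI:
  assumes "dist u (c k) < r k"
  shows "index u = k"
proof (rule ccontr)
  assume neq: "index u \<noteq> k"
  have "dist u (c (index u)) < r (index u)"
    unfolding index_def using assms by (rule someI)
  then show False
    using assms separated[OF neq] r[of k] r[of "index u"] dist_triangle3[of "c (index u)" "c k" u]
    by linarith
qed

lemma bump_eq: "dist u (c k) < r k \<Longrightarrow> bump u = (T * (r k - dist u (c k))) *\<^sub>R e k"
  by (simp add: bump_def index_eqI tent_def)

lemma tent_lipschitz: "\<bar>tent k u - tent k w\<bar> \<le> T * dist u w"
proof -
  have "\<bar>tent k u - tent k w\<bar> = T * \<bar>max 0 (r k - dist u (c k)) - max 0 (r k - dist w (c k))\<bar>"
    using T by (simp add: tent_def abs_mult flip: right_diff_distrib)
  also have "\<dots> \<le> T * dist u w"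
    using T dist_triangle[of u "c k" w] dist_triangle[of w "c k" u]
    by (intro mult_left_mono) (auto simp: dist_commute)
  finally show ?thesis .
qed

text \<open>Different directions do not worsen the constant \<open>T\<close>. For points in two
  different balls the radii sum to at most 2 while the centers are 4 apart, so the two heights
  together are at most \<open>T * dist u w\<close> by the triangle inequality.\<close>

lemma lipschitz_bump: "T-lipschitz_on UNIV bump"
proof (rule lipschitz_onI)
  fix u w :: 'a
  show "dist (bump u) (bump w) \<le> T * dist u w"
  proof (cases "index u = index w")
    case True
    then have "bump u - bump w = (tent (index u) u - tent (index u) w) *\<^sub>R e (index u)"
      by (simp add: bump_def scaleR_diff_left)
    then show ?thesis using e tent_lipschitz by (simp add: dist_norm)
  next
    case False
    have zero: "tent (index u) w = 0" "tent (index w) u = 0"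
      using False index_eqI tent_pos_iff tent_nonneg by (metis less_eq_real_def)+
    have "dist (bump u) (bump w) \<le> tent (index u) u + tent (index w) w"
      unfolding dist_norm norm_bump[symmetric] by (rule norm_triangle_ineq4)
    also have "\<dots> \<le> T * dist u w"
    proof (cases "0 < tent (index u) u \<and> 0 < tent (index w) w")
      case True
      then have "tent (index u) u + tent (index w) w =
          T * (r (index u) - dist u (c (index u)) + (r (index w) - dist w (c (index w))))"
        by (simp add: tent_pos_iff) (simp add: tent_def algebra_simps)
      also have "\<dots> \<le> T * dist u w"
        using T r(2)[of "index u"] r(2)[of "index w"] separated[OF False]
          dist_triangle[of "c (index u)" "c (index w)" u] dist_triangle[of u "c (index w)" w]
        by (intro mult_left_mono) (auto simp: dist_commute)
      finally show ?thesis .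
    next
      case False
      then show ?thesis
        using tent_lipschitz[of "index u" u w] tent_lipschitz[of "index w" u w]
          tent_nonneg[of "index u" u] tent_nonneg[of "index w" w] zero by auto
    qed
    finally show ?thesis .
  qed
qed (use T in simp)

lemma bump_tendsto_0:
  assumes "r \<longlonglongrightarrow> 0"
  shows "((\<lambda>u. norm (bump u)) \<longlongrightarrow> 0) at_infinity"
proof (rule tendstoI)
  fix \<epsilon> :: real assume "\<epsilon> > 0"
  then have "\<forall>\<^sub>F k in sequentially. r k < \<epsilon> / T"
    using T by (intro order_tendstoD(2)[OF assms]) auto
  then obtain N where N: "\<And>k. k \<ge> N \<Longrightarrow> r k < \<epsilon> / T"
    by (auto simp: eventually_sequentially)
  \<comment> \<open>Only the first \<open>N\<close> bumps can reach height
    \<open>\<epsilon>\<close>, and beyond \<open>M\<close> all of their balls have been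
    left.\<close>
  define M where "M = Max (insert 0 ((\<lambda>k. norm (c k)) ` {..<N})) + 1"
  have M: "norm (c k) + 1 \<le> M" if "k < N" for k
    unfolding M_def using that by simp
  have "norm (bump u) < \<epsilon>" if u: "norm u \<ge> M" for u
  proof (cases "0 < tent (index u) u")
    case True
    then have near: "dist u (c (index u)) < r (index u)" by (simp add: tent_pos_iff)
    have "norm u \<le> norm (c (index u)) + dist u (c (index u))"
      unfolding dist_norm by (rule norm_triangle_sub)
    then have "index u \<ge> N"
      using near r(2)[of "index u"] M[of "index u"] u by linarith
    have "norm (bump u) \<le> T * r (index u)"
      using T r(1)[of "index u"] by (auto simp: norm_bump tent_def)
    also have "\<dots> < \<epsilon>" using N[OF \<open>index u \<ge> N\<close>] T by (simp add: less_divide_eq mult.commute)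
    finally show ?thesis .
  next
    case False
    then show ?thesis using \<open>\<epsilon> > 0\<close> by (simp add: norm_bump)
  qed
  then show "\<forall>\<^sub>F u in at_infinity. dist (norm (bump u)) 0 < \<epsilon>"
    by (auto simp: eventually_at_infinity)
qed

lemma rank_one_lipschitz_bump: "rank_one_lipschitz bump"
  unfolding rank_one_lipschitz_def
proof
  fix x
  have "\<exists>k. \<forall>u\<in>ball x 1. bump u = tent k u *\<^sub>R e k"
  proof (cases "\<exists>k. \<exists>w\<in>ball x 1. dist w (c k) < r k")
    case True
    then obtain k w where w: "dist x w < 1" "dist w (c k) < r k" by auto
    have "bump u = tent k u *\<^sub>R e k" if u: "dist x u < 1" for u
    proof (cases "index u = k")
      case False
      have "\<not> dist u (c (index u)) < r (index u)"
        using w u separated[OF False] r(2)[of k] r(2)[of "index u"]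
          dist_triangle[of "c (index u)" "c k" u] dist_triangle[of u "c k" w]
          dist_triangle3[of u w x]
        by (auto simp: dist_commute)
      moreover have "\<not> dist u (c k) < r k" using False index_eqI by blast
      ultimately show ?thesis by (simp add: bump_def tent_def)
    qed (simp add: bump_def)
    then show ?thesis by auto
  next
    case False
    \<comment> \<open>All tents vanish on this ball, so index 0 is an arbitrary choice.\<close>
    then have "bump u = tent 0 u *\<^sub>R e 0" if "u \<in> ball x 1" for u
      using that by (auto simp: bump_def tent_def not_less)
    then show ?thesis by blast
  qed
  then obtain k where k: "\<forall>u\<in>ball x 1. bump u = tent k u *\<^sub>R e k" by blast
  have "T-lipschitz_on (ball x 1) (tent k)"
    using tent_lipschitz T by (intro lipschitz_onI) (auto simp: dist_real_def)
  with k show "\<exists>U. x \<in> interior U \<and>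
       (\<exists>(\<xi>::'a \<Rightarrow> real) y. (\<exists>L. L-lipschitz_on U \<xi>) \<and> (\<forall>u\<in>U. bump u = \<xi> u *\<^sub>R y))"
    by (intro exI[of _ "ball x 1"] conjI exI[of _ "tent k"] exI[of _ "e k"] exI[of _ T]) auto
qed

end

section \<open>Construction of a perturbation that destroys regularity\<close>

text \<open>One bump is placed at each of a sequence of failure points going to infinity. The
  \<open>k\<close>-th bump refutes the constant \<open>\<kappa>\<close> once \<open>k\<close>
  exceeds \<open>\<kappa> * T\<close> and the \<open>k\<close>-th point and target lie in the
  neighborhoods given with \<open>\<kappa>\<close>.\<close>

lemma destabilizing_perturbation:
  fixes F :: "'a::banach \<Rightarrow> 'b::banach set"
  assumes closed: "closed (gph F)"
    and nreg: "\<not> metrically_regular_with (1 / \<tau>) F ybar"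
    and \<tau>: "0 < \<tau>" "\<tau> < T"
  obtains f where "T-lipschitz_on UNIV f" "((\<lambda>x. norm (f x)) \<longlongrightarrow> 0) at_infinity"
    "rank_one_lipschitz f" "\<not> metrically_regular_at_infinity (plus_map F f) ybar"
proof -
  have T: "T > 0" using \<tau> by simp
  \<comment> \<open>The bound \<open>d < 2 * T\<close> will make the radii at most 1, and the
    tolerance \<open>1 / Suc k\<close> makes them tend to 0.\<close>
  define P where "P k s \<longleftrightarrow> (case s of (x, v, n, d) \<Rightarrow> real k \<le> norm x \<and> v \<in> F x \<and>
      norm (v - ybar) < 1 / Suc k \<and> norm n = 1 \<and> 0 < d \<and> d < 1 / Suc k \<and> d < 2 * T \<and>
      (\<forall>x' s. 0 \<le> s \<longrightarrow> s \<le> d \<longrightarrow> v - s *\<^sub>R n \<in> F x' \<longrightarrow> s \<le> T * dist x x'))"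
    for k :: nat and s :: "'a \<times> 'b \<times> 'b \<times> real"
  have ex: "\<exists>s. P k s \<and> B \<le> norm (fst s)" for k B
  proof -
    have "0 < min (1 / Suc k) (2 * T)" using T by simp
    from not_metrically_regular_withD[OF closed nreg \<tau> this, of "max (real k) B"]
    obtain x v n d where "norm x \<ge> max (real k) B" "v \<in> F x"
      "norm (v - ybar) < min (1 / Suc k) (2 * T)" "norm n = 1" "0 < d"
      "d < min (1 / Suc k) (2 * T)"
      "\<And>x' s. 0 \<le> s \<Longrightarrow> s \<le> d \<Longrightarrow> v - s *\<^sub>R n \<in> F x' \<Longrightarrow> s \<le> T * dist x x'"
      by blast
    then show ?thesis by (intro exI[of _ "(x, v, n, d)"]) (auto simp: P_def)
  qed
  \<comment> \<open>Norms growing by 4 at each step force the centers to be 4 apart.\<close>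
  obtain s where s: "\<And>k. P k (s k)" "\<And>k. norm (fst (s k)) + 4 \<le> norm (fst (s (Suc k)))"
    using dependent_nat_choice[of P "\<lambda>k s s'. norm (fst s) + 4 \<le> norm (fst s')"] ex by metis
  define x v n d where "x k = fst (s k)" and "v k = fst (snd (s k))"
    and "n k = fst (snd (snd (s k)))" and "d k = snd (snd (snd (s k)))" for k
  have sk: "s k = (x k, v k, n k, d k)" for k
    by (simp add: x_def v_def n_def d_def)
  have xvn: "real k \<le> norm (x k)" "v k \<in> F (x k)" "norm (v k - ybar) < 1 / Suc k" "norm (n k) = 1"
    and d: "0 < d k" "d k < 1 / Suc k" "d k < 2 * T" for k
    using s(1)[of k] unfolding P_def sk by auto
  have avoid: "a \<le> T * dist (x k) x'" if "0 \<le> a" "a \<le> d k" "v k - a *\<^sub>R n k \<in> F x'" for k a x'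
    using s(1)[of k] that unfolding P_def sk by auto
  have step: "norm (x k) + 4 \<le> norm (x (Suc k))" for k using s(2) by (simp add: x_def)
  have gap: "norm (x i) + 4 \<le> norm (x j)" if "i < j" for i j
    using that
  proof (induction j rule: less_Suc_induct)
    case (1 i)
    show ?case by (rule step)
  qed linarith
  have sep: "4 \<le> dist (x i) (x j)" if "i \<noteq> j" for i j
    using that gap[of i j] gap[of j i] norm_triangle_ineq2[of "x i" "x j"]
      norm_triangle_ineq2[of "x j" "x i"]
    by (cases "i < j") (auto simp: dist_norm norm_minus_commute)
  \<comment> \<open>Half of the length \<open>d k\<close> is the height \<open>T * r k\<close> of
    the bump; the other half leaves room for the overshoot \<open>\<delta>\<close>.\<close>
  define r where "r k = d k / (2 * T)" for k
  have rk: "0 < r k" "r k \<le> 1" "d k = 2 * (T * r k)" for k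
    using d T by (auto simp: r_def less_imp_le)
  interpret separated_bumps T x r "\<lambda>k. - n k"
    using T rk xvn sep by unfold_locales auto
  have lim: "(\<lambda>k. C / real (Suc k)) \<longlonglongrightarrow> 0" for C
    using LIMSEQ_Suc[OF lim_const_over_n[of C]] by simp
  have "d \<longlonglongrightarrow> 0"
    by (rule Lim_null_comparison[OF always_eventually lim[of 1]]) (use d in \<open>auto simp: less_imp_le\<close>)
  then have "r \<longlonglongrightarrow> 0"
    unfolding r_def using tendsto_divide_zero by blast
  moreover have "\<not> metrically_regular_with \<kappa> (plus_map F bump) ybar" for \<kappa>
  proof
    assume "metrically_regular_with \<kappa> (plus_map F bump) ybar"
    then obtain \<gamma> \<rho> \<eta> where \<kappa>: "\<kappa> > 0" and \<gamma>: "\<gamma> > 0" and \<eta>: "\<eta> > 0"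
      and mr: "\<And>x y. norm x \<ge> \<rho> \<Longrightarrow> dist ybar y < \<eta> \<Longrightarrow>
        edist_set y (plus_map F bump x) < ereal \<gamma> \<Longrightarrow>
        edist_set x (inv_map (plus_map F bump) y) \<le> ereal \<kappa> * edist_set y (plus_map F bump x)"
      by (rule metrically_regular_withE) blast
    have "\<forall>\<^sub>F k in sequentially. 2 / real (Suc k) < min \<eta> \<gamma>"
      using \<eta> \<gamma> by (intro order_tendstoD(2)[OF lim]) auto
    moreover have "\<forall>\<^sub>F k in sequentially. max \<rho> (\<kappa> * T) < real k"
      using filterlim_real_sequentially unfolding filterlim_at_top_dense by blast
    ultimately have "\<forall>\<^sub>F k in sequentially. 2 / real (Suc k) < min \<eta> \<gamma> \<and> max \<rho> (\<kappa> * T) < real k"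
      by (rule eventually_conj)
    then obtain k where k: "2 / real (Suc k) < min \<eta> \<gamma>" "max \<rho> (\<kappa> * T) < real k"
      by (auto simp: eventually_sequentially)
    \<comment> \<open>Small enough that \<open>\<kappa> * \<delta> < r k\<close>, so regularity
      would yield a solution inside the \<open>k\<close>-th ball.\<close>
    define \<delta> where "\<delta> = r k * T / Suc k"
    have \<delta>: "0 < \<delta>" "\<delta> \<le> T * r k"
      using rk(1)[of k] T by (auto simp: \<delta>_def divide_le_eq mult.commute)
    \<comment> \<open>This overshoots the perturbed value \<open>v k + bump (x k)\<close> by
      \<open>\<delta>\<close> in the direction \<open>- n k\<close>.\<close>
    define w where "w = v k - (T * r k + \<delta>) *\<^sub>R n k"
    have bx: "bump (x k) = (T * r k) *\<^sub>R - n k"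
      using rk(1)[of k] bump_eq[of "x k" k] by simp
    have "norm (w - ybar) \<le> norm (v k - ybar) + (T * r k + \<delta>)"
    proof -
      have "w - ybar = (v k - ybar) - (T * r k + \<delta>) *\<^sub>R n k"
        by (simp add: w_def)
      then have "norm (w - ybar) \<le> norm (v k - ybar) + norm ((T * r k + \<delta>) *\<^sub>R n k)"
        using norm_triangle_ineq4 by metis
      then show ?thesis using xvn(4)[of k] \<delta> T rk(1)[of k] by simp
    qed
    also have "\<dots> < 1 / Suc k + 1 / Suc k"
      using xvn(3)[of k] d(2)[of k] rk(3)[of k] \<delta> by linarith
    also have "\<dots> = 2 / Suc k" by simp
    finally have wV: "dist ybar w < \<eta>" using k by (simp add: dist_norm norm_minus_commute)
    have "edist_set w (plus_map F bump (x k)) \<le> ereal (dist (w - bump (x k)) (v k))"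
      unfolding edist_set_plus_map using xvn by (intro edist_set_le)
    also have "w - bump (x k) = v k - \<delta> *\<^sub>R n k"
      by (simp add: w_def bx algebra_simps)
    also have "dist (v k - \<delta> *\<^sub>R n k) (v k) = \<delta>"
      using \<delta> xvn(4)[of k] by (simp add: dist_norm)
    finally have dw: "edist_set w (plus_map F bump (x k)) \<le> ereal \<delta>" .
    have "1 / real (Suc k) \<le> 2 / real (Suc k)" by (simp add: divide_right_mono)
    then have "\<delta> < \<gamma>" using \<delta> d(1,2)[of k] rk(3)[of k] k by linarith
    then have "edist_set w (plus_map F bump (x k)) < ereal \<gamma>"
      using dw by (meson ereal_less_le less_ereal.simps(1) order_le_less_trans)
    then have "edist_set (x k) (inv_map (plus_map F bump) w)
        \<le> ereal \<kappa> * edist_set w (plus_map F bump (x k))"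
      using xvn(1)[of k] k wV by (intro mr) auto
    also have "\<dots> \<le> ereal \<kappa> * ereal \<delta>"
      using dw \<kappa> by (intro ereal_mult_left_mono) auto
    also have "\<dots> < ereal (r k)"
    proof -
      have "\<kappa> * T * r k < Suc k * r k"
        using k rk(1)[of k] by (intro mult_strict_right_mono) auto
      then show ?thesis
        by (simp add: \<delta>_def divide_less_eq algebra_simps)
    qed
    finally obtain u where u: "w - bump u \<in> F u" "dist (x k) u < r k"
      by (auto simp: edist_set_less_iff mem_inv_map_plus_map)
    \<comment> \<open>Moving away from the center lowers the bump at rate \<open>T\<close>, so the
      target seen by \<open>F\<close> is shifted by \<open>a\<close>, which exceeds
      \<open>T * dist u (x k)\<close> by \<open>\<delta>\<close>; \<open>avoid\<close> forbids
      this.\<close>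
    define a where "a = \<delta> + T * dist u (x k)"
    have "bump u = (T * (r k - dist u (x k))) *\<^sub>R - n k"
      using u by (intro bump_eq) (simp add: dist_commute)
    then have "w - bump u = v k - a *\<^sub>R n k"
      by (simp add: w_def a_def algebra_simps)
    moreover have "T * dist u (x k) \<le> T * r k"
      using u T by (intro mult_left_mono) (auto simp: dist_commute)
    then have "a \<le> d k" using \<delta> rk(3)[of k] by (simp only: a_def)
    moreover have "0 \<le> a" using \<delta> T by (simp add: a_def)
    ultimately have "a \<le> T * dist (x k) u"
      using u by (intro avoid) auto
    then show False using \<delta> by (simp add: a_def dist_commute)
  qed
  ultimately show thesis
    using that[OF lipschitz_bump bump_tendsto_0 rank_one_lipschitz_bump]
    by (auto simp: metrically_regular_at_infinity_def)
qed

section \<open>Comparison of the infimum with the reciprocal of the modulus\<close>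

theorem theorem3p2:
  fixes F :: "'a::banach \<Rightarrow> 'b::banach set" and ybar :: 'b
  assumes "closed (gph F)" and "ybar \<in> jelonek_set F"
  shows "(INF f\<in>{f \<in> perturbations. \<not> metrically_regular_at_infinity (plus_map F f) ybar}.
            lip_infinity f) \<ge> 1 / reg_infinity F ybar \<and>
    (finite_dim_euclidean TYPE('a) \<and> finite_dim_euclidean TYPE('b) \<longrightarrow>
       (INF f\<in>{f \<in> perturbations. \<not> metrically_regular_at_infinity (plus_map F f) ybar}.
          lip_infinity f) = 1 / reg_infinity F ybar \<and>
       (INF f\<in>{f \<in> perturbations. rank_one_lipschitz f \<and>
            \<not> metrically_regular_at_infinity (plus_map F f) ybar}. lip_infinity f) =
       (INF f\<in>{f \<in> perturbations. \<not> metrically_regular_at_infinity (plus_map F f) ybar}.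
          lip_infinity f))"
proof -
  let ?A = "{f \<in> perturbations. \<not> metrically_regular_at_infinity (plus_map F f) ybar}"
  let ?B = "{f \<in> perturbations. rank_one_lipschitz f \<and>
      \<not> metrically_regular_at_infinity (plus_map F f) ybar}"
  let ?reg = "reg_infinity F ybar"
  obtain xs where xs: "filterlim (\<lambda>k. norm (xs k :: 'a)) at_top sequentially"
    using assms(2) by (auto simp: jelonek_set_def)
  have reg0: "0 \<le> ?reg"
    unfolding reg_infinity_def by (rule Inf_greatest) (auto simp: metrically_regular_with_def)
  have inv0: "0 \<le> 1 / ?reg"
    using reg0 by (cases ?reg) (auto simp: divide_ereal_def)
  \<comment> \<open>These pass between the modulus and its reciprocal, including the values 0 and
    infinity of \<open>?reg\<close>.\<close>
  have less_iff: "1 / ?reg < ereal L \<longleftrightarrow> ereal (1 / L) < ?reg"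
    and greater_iff: "ereal L < 1 / ?reg \<longleftrightarrow> ?reg < ereal (1 / L)" if "L > 0" for L
    using reg0 that
    by (cases ?reg; cases "?reg = 0"; force simp: divide_ereal_def field_simps)+
  have "1 / ?reg \<le> lip_infinity f" if "f \<in> ?A" for f
  proof (rule ccontr)
    assume "\<not> ?thesis"
    then have "lip_infinity f < 1 / ?reg" by simp
    then obtain L where L: "lip_infinity f < ereal L" "ereal L < 1 / ?reg"
      using ereal_dense2 by blast
    have "L > 0" using L(1) lip_infinity_nonneg[OF xs, of f] by (metis ereal_less(2) order_le_less_trans)
    with L have "?reg < ereal (1 / L)" by (simp add: greater_iff)
    then obtain \<kappa> where \<kappa>: "metrically_regular_with \<kappa> F ybar" "\<kappa> < 1 / L"
      by (auto simp: reg_infinity_def Inf_less_iff)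
    have "metrically_regular_at_infinity (plus_map F f) ybar"
      using that \<open>L > 0\<close> L \<kappa>
      by (intro metrically_regular_plus_map[OF assms(1) \<kappa>(1) _ L(1)])
        (auto simp: perturbations_def less_divide_eq)
    then show False using that by simp
  qed
  then have lower: "1 / ?reg \<le> (INF f\<in>?A. lip_infinity f)"
    by (rule INF_greatest)
  have AB: "(INF f\<in>?A. lip_infinity f) \<le> (INF f\<in>?B. lip_infinity f)"
    by (rule INF_superset_mono) auto
  have "(INF f\<in>?B. lip_infinity f) \<le> 1 / ?reg"
  proof (rule ccontr)
    assume "\<not> ?thesis"
    \<comment> \<open>Both \<open>\<tau>\<close> and \<open>T\<close> go strictly between
      \<open>1 / ?reg\<close> and the infimum: regularity fails with constant
      \<open>1 / \<tau>\<close>, and the perturbation built from this has modulus at most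
      \<open>T\<close>.\<close>
    then obtain T where T: "1 / ?reg < ereal T" "ereal T < (INF f\<in>?B. lip_infinity f)"
      using ereal_dense2[of "1 / ?reg" "INF f\<in>?B. lip_infinity f"] by (auto simp only: not_le)
    obtain \<tau> where \<tau>: "1 / ?reg < ereal \<tau>" "ereal \<tau> < ereal T"
      using ereal_dense2[OF T(1)] by blast
    have "\<tau> > 0" using \<tau>(1) inv0 by (metis ereal_less(2) order_le_less_trans)
    then have "ereal (1 / \<tau>) < ?reg" using \<tau> by (simp add: less_iff)
    moreover have "?reg \<le> ereal (1 / \<tau>)" if "metrically_regular_with (1 / \<tau>) F ybar"
      unfolding reg_infinity_def using that by (intro Inf_lower) auto
    ultimately have "\<not> metrically_regular_with (1 / \<tau>) F ybar"
      by (auto simp: not_less)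
    then obtain f where f: "T-lipschitz_on UNIV f" "((\<lambda>x. norm (f x)) \<longlongrightarrow> 0) at_infinity"
      "rank_one_lipschitz f" "\<not> metrically_regular_at_infinity (plus_map F f) ybar"
      using destabilizing_perturbation[OF assms(1) _ \<open>\<tau> > 0\<close>, of ybar T] \<tau> by auto
    have lip: "lip_infinity f \<le> ereal T" by (rule lip_infinity_le[OF f(1)])
    then have "f \<in> ?B" using f by (auto simp: perturbations_def)
    then have "(INF f\<in>?B. lip_infinity f) \<le> ereal T" by (rule INF_lower2) (rule lip)
    with T show False by simp
  qed
  \<comment> \<open>The cycle of inequalities from \<open>1 / ?reg\<close> through the infima over
    \<open>?A\<close> and \<open>?B\<close> back to \<open>1 / ?reg\<close> forces equality
    throughout.\<close>
  with lower AB show ?thesis by auto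
qed

end
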